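(* Let $u\in DX$. Then there is a minimal $X$-weak upper gradient $g_u\in X$ of $u$, i.e., an $X$-weak upper gradient $g_u\in X$ of $u$ such that $g_u\le g$ $\mu$-a.e. for all $X$-weak upper gradients $g\in X$ of $u$. Moreover, $g_u$ is unique up to sets of $\mu$-measure zero.
   Context: Setting: $\mathcal P=(\mathcal P,d,\mu)$ is a metric space equipped with a $\sigma$-finite Borel regular measure $\mu$ (all Borel sets are $\mu$-measurable, and each $\mu$-measurable set $A$ is contained in a Borel set $D$ with $\mu(D)=\mu(A)$) such that every ball has finite positive measure. $\mathcal M(\mathcal P,\mu)$ is the set of all extended real-valued $\mu$-measurable functions on $\mathcal P$. $X$ is a quasi-Banach function lattice: there is a functional $\|\cdot\|_X:\mathcal M(\mathcal P,\mu)\to[0,\infty]$ with (P0) $X=\{u\in\mathcal M(\mathcal P,\mu):\|u\|_X<\infty\}$; (P1) $\|u\|_X=0$ iff $u=0$ a.e., $\|au\|_X=|a|\|u\|_X$ for $a\in\mathbb R$, and there is a constant $c\ge1$ (modulus of concavity) with $\|u+v\|_X\le c(\|u\|_X+\|v\|_X)$ for all $u,v$; (P2) if $|u|\le|v|$ a.e. then $\|u\|_X\le\|v\|_X$; (RF) if $u_n\ge0$ a.e. for all $n\in\mathbb N=\{1,2,\dots\}$, then $\|\sum_{n=1}^\infty u_n\|_X\le\sum_{n=1}^\infty c^n\|u_n\|_X$ (pointwise a.e. sum). The quasi-norm is assumed continuous: $\|u_n-u\|_X\to0$ implies $\|u_n\|_X\to\|u\|_X$. Elements of $X$ are functions defined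 everywhere on $\mathcal P$ (not equivalence classes); they are finite a.e. A curve is a rectifiable non-constant continuous map from a compact interval into $\mathcal P$, always parameterized by arc length, $\gamma:[0,l_\gamma]\to\mathcal P$; $ds$ is arc length. The $X$-modulus of a family $\Gamma$ of curves is $\mathrm{Mod}_X(\Gamma)=\inf\|\rho\|_X$ over all Borel $\rho:\mathcal P\to[0,\infty]$ with $\int_\gamma\rho\,ds\ge1$ for all $\gamma\in\Gamma$. A property holds for $\mathrm{Mod}_X$-a.e. curve if the exceptional family has zero $X$-modulus. For a non-negative measurable $g$, $\int_\gamma g\,ds$ is well defined in $[0,\infty]$ for $\mathrm{Mod}_X$-a.e. $\gamma$. A Borel function $g:\mathcal P\to[0,\infty]$ is an upper gradient of $u:\mathcal P\to\mathbb R\cup\{\pm\infty\}$ if $|u(\gamma(0))-u(\gamma(l_\gamma))|\le\int_\gamma g\,ds$ for all curves $\gamma$, with the convention $|(\pm\infty)-(\pm\infty)|=\infty$. A non-negative (possibly $\infty$-valued) $\mu$-measurable $g$ is an $X$-weak upper gradient of $u$ if this inequality holds for $\mathrm{Mod}_X$-a.e. curve. The Dirichlet space $DX$ is the set of measurable (extended real-valued) functions having an upper gradient in $X$. *)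

theory Defs
  imports "HOL-Analysis.Analysis"
begin

text \<open>
  The metric space is the whole type. The algebra of measurable sets may be larger than the
  Borel algebra, and the measure need not be complete.
\<close>

locale borel_regular_metric_measure = sigma_finite_measure M
  for M :: "'a::metric_space measure" +
  assumes space_UNIV: "space M = UNIV"
    and borel_measurable_sets: "sets borel \<subseteq> sets M"
    and borel_regular:
      "A \<in> sets M \<Longrightarrow> \<exists>D\<in>sets borel. A \<subseteq> D \<and> emeasure M D = emeasure M A"
    and ball_pos_finite: "0 < r \<Longrightarrow> 0 < emeasure M (ball x r) \<and> emeasure M (ball x r) < \<infinity>"

text \<open>
  \<open>N\<close> is the functional on all extended real-valued measurable functions; its values at
  non-measurable functions are irrelevant.
\<close>

definition lattice_space ::
  "'a measure \<Rightarrow> (('a \<Rightarrow> ereal) \<Rightarrow> ennreal) \<Rightarrow> ('a \<Rightarrow> ereal) set" where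
  "lattice_space M N = {u \<in> borel_measurable M. N u < \<infinity>}"

text \<open>
  On \<open>ereal\<close> the undefined sum \<open>\<infinity> + (-\<infinity>)\<close> equals \<open>\<infinity>\<close>. This does not affect the quasi-triangle
  inequality: its right-hand side is infinite unless \<open>u\<close> and \<open>v\<close> are finite almost everywhere.
  In \<open>riesz_fischer\<close> the sequence is indexed from 0, so its \<open>n\<close>-th term carries \<open>c ^ Suc n\<close>.
\<close>

locale quasi_banach_function_lattice = borel_regular_metric_measure M
  for M :: "'a::metric_space measure" +
  fixes N :: "('a \<Rightarrow> ereal) \<Rightarrow> ennreal" and c :: real
  assumes norm_zero_iff: "u \<in> borel_measurable M \<Longrightarrow> N u = 0 \<longleftrightarrow> (AE x in M. u x = 0)"
    and norm_scale: "u \<in> borel_measurable M \<Longrightarrow> N (\<lambda>x. ereal a * u x) = ennreal \<bar>a\<bar> * N u"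
    and concavity_ge_1: "1 \<le> c"
    and quasi_triangle:
      "\<lbrakk>u \<in> borel_measurable M; v \<in> borel_measurable M\<rbrakk>
        \<Longrightarrow> N (\<lambda>x. u x + v x) \<le> ennreal c * (N u + N v)"
    and lattice_property:
      "\<lbrakk>u \<in> borel_measurable M; v \<in> borel_measurable M; AE x in M. \<bar>u x\<bar> \<le> \<bar>v x\<bar>\<rbrakk>
        \<Longrightarrow> N u \<le> N v"
    and riesz_fischer:
      "\<lbrakk>\<And>n::nat. f n \<in> borel_measurable M; \<And>n. AE x in M. 0 \<le> f n x;
        s \<in> borel_measurable M; AE x in M. (\<lambda>n. f n x) sums s x\<rbrakk>
        \<Longrightarrow> N s \<le> (\<Sum>n. ennreal c ^ Suc n * N (f n))"
    and norm_continuous: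
      "\<lbrakk>\<And>n::nat. f n \<in> lattice_space M N; u \<in> lattice_space M N;
        (\<lambda>n. N (\<lambda>x. f n x - u x)) \<longlonglongrightarrow> 0\<rbrakk>
        \<Longrightarrow> (\<lambda>n. N (f n)) \<longlonglongrightarrow> N u"

definition curve_length :: "(real \<Rightarrow> 'a::metric_space) \<Rightarrow> real \<Rightarrow> real \<Rightarrow> ennreal" where
  "curve_length \<gamma> a b =
    Sup {\<Sum>i<n. ennreal (dist (\<gamma> (t i)) (\<gamma> (t (Suc i)))) | (n::nat) (t::nat \<Rightarrow> real).
         mono_on {..n} t \<and> t 0 = a \<and> t n = b}"

text \<open>
  A pair \<open>(\<gamma>, l)\<close> stands for the restriction of \<open>\<gamma>\<close> to \<open>{0..l}\<close>; values of \<open>\<gamma>\<close> elsewhere are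
  irrelevant. For an arc length parametrization, rectifiable means that \<open>l\<close> is finite, and
  non-constant means \<open>0 < l\<close>.
\<close>

type_synonym 'a curve = "(real \<Rightarrow> 'a) \<times> real"

definition curves :: "'a::metric_space curve set" where
  "curves = {(\<gamma>, l). 0 < l \<and> continuous_on {0..l} \<gamma> \<and>
                     (\<forall>s\<in>{0..l}. curve_length \<gamma> 0 s = ennreal s)}"

definition line_integral :: "'a curve \<Rightarrow> ('a \<Rightarrow> ennreal) \<Rightarrow> ennreal" where
  "line_integral p g = (\<integral>\<^sup>+t. g (fst p t) \<partial>lebesgue_on {0..snd p})"

definition modulus ::
  "(('a::metric_space \<Rightarrow> ereal) \<Rightarrow> ennreal) \<Rightarrow> 'a curve set \<Rightarrow> ennreal" where
  "modulus N \<Gamma> =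
    Inf {N (\<lambda>x. enn2ereal (\<rho> x)) | \<rho>::'a \<Rightarrow> ennreal.
         \<rho> \<in> borel_measurable borel \<and> (\<forall>p\<in>\<Gamma>. 1 \<le> line_integral p \<rho>)}"

definition ae_curve ::
  "(('a::metric_space \<Rightarrow> ereal) \<Rightarrow> ennreal) \<Rightarrow> ('a curve \<Rightarrow> bool) \<Rightarrow> bool" where
  "ae_curve N P \<longleftrightarrow> modulus N {p \<in> curves. \<not> P p} = 0"

text \<open>The convention \<open>\<bar>(\<plusminus>\<infinity>) - (\<plusminus>\<infinity>)\<bar> = \<infinity>\<close> is what \<open>ereal\<close> arithmetic yields.\<close>

lemma abs_diff_infinite_ereal:
  fixes a b :: ereal
  assumes "\<bar>a\<bar> = \<infinity>" and "\<bar>b\<bar> = \<infinity>"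
  shows "\<bar>a - b\<bar> = \<infinity>"
  using assms by (cases a; cases b) auto

definition gradient_ineq ::
  "('a::metric_space \<Rightarrow> ereal) \<Rightarrow> ('a \<Rightarrow> ennreal) \<Rightarrow> 'a curve \<Rightarrow> bool" where
  "gradient_ineq u g p \<longleftrightarrow>
    \<bar>u (fst p 0) - u (fst p (snd p))\<bar> \<le> enn2ereal (line_integral p g)"

definition upper_gradient :: "('a::metric_space \<Rightarrow> ereal) \<Rightarrow> ('a \<Rightarrow> ennreal) \<Rightarrow> bool" where
  "upper_gradient u g \<longleftrightarrow> g \<in> borel_measurable borel \<and> (\<forall>p\<in>curves. gradient_ineq u g p)"

text \<open>
  A measurable \<open>g\<close> need not be measurable along every curve. Curves along which its line integral
  is not well defined count as exceptional.
\<close>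

definition weak_upper_gradient ::
  "'a::metric_space measure \<Rightarrow> (('a \<Rightarrow> ereal) \<Rightarrow> ennreal) \<Rightarrow> ('a \<Rightarrow> ereal) \<Rightarrow> ('a \<Rightarrow> ennreal) \<Rightarrow> bool"
  where
  "weak_upper_gradient M N u g \<longleftrightarrow>
    g \<in> borel_measurable M \<and>
    ae_curve N (\<lambda>p. (\<lambda>t. g (fst p t)) \<in> borel_measurable (lebesgue_on {0..snd p}) \<and>
                    gradient_ineq u g p)"

definition dirichlet_space ::
  "'a::metric_space measure \<Rightarrow> (('a \<Rightarrow> ereal) \<Rightarrow> ennreal) \<Rightarrow> ('a \<Rightarrow> ereal) set" where
  "dirichlet_space M N =
    {u \<in> borel_measurable M. \<exists>g. upper_gradient u g \<and> (\<lambda>x. enn2ereal (g x)) \<in> lattice_space M N}"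

definition minimal_weak_upper_gradient ::
  "'a::metric_space measure \<Rightarrow> (('a \<Rightarrow> ereal) \<Rightarrow> ennreal) \<Rightarrow> ('a \<Rightarrow> ereal) \<Rightarrow> ('a \<Rightarrow> ennreal) \<Rightarrow> bool"
  where
  "minimal_weak_upper_gradient M N u g \<longleftrightarrow>
    weak_upper_gradient M N u g \<and> (\<lambda>x. enn2ereal (g x)) \<in> lattice_space M N \<and>
    (\<forall>h. weak_upper_gradient M N u h \<and> (\<lambda>x. enn2ereal (h x)) \<in> lattice_space M N
      \<longrightarrow> (AE x in M. g x \<le> h x))"

end

theory Submission
  imports Defs
begin

text \<open>
  Let \<open>G\<close> be the set of weak upper gradients of \<open>u\<close> that lie in \<open>X\<close>. It contains an upper gradient of
  \<open>u\<close>, and the point of the proof is that it is closed under countable pointwise infima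
  (\<open>lattice_weak_upper_gradients_INF\<close>). A nonempty set of measurable functions with this closure
  property on a \<open>\<sigma>\<close>-finite measure space has a member that lies below every other member almost
  everywhere: a sequence along which a bounded, strictly monotone integral functional approaches
  its supremum over the set has such an infimum (\<open>ex_AE_least\<close>). This member is the minimal weak
  upper gradient, and uniqueness is antisymmetry.

  The closure property is proved curve by curve. Countably many exceptional families together
  still have modulus zero, by the Riesz-Fischer property. Almost every curve \<open>\<gamma>\<close> therefore has the
  following properties for all \<open>f n\<close> of a given sequence in \<open>G\<close> at once: \<open>f n\<close> has finite integral
  along \<open>\<gamma>\<close>, and it satisfies the gradient inequality on each subcurve, since the curves that
  have an exceptional subcurve again have modulus zero. On such a curve \<open>u \<circ> \<gamma>\<close> is finite, and
  its increment over any subinterval is at most the integral of any \<open>f n \<circ> \<gamma>\<close> over it. Classically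
  \<open>u \<circ> \<gamma>\<close> is then absolutely continuous, and almost everywhere the modulus of its derivative is at most
  each \<open>f n \<circ> \<gamma>\<close>, hence at most their infimum. The proof below avoids differentiation: on a fine
  tagged division the integrals of two bounds over the pieces are, in total, close to length times
  value at the tag, so the smaller of the two is close to the integral of the minimum
  (\<open>increment_le_integral_min\<close>). From finite minima to the infimum one passes by monotone
  convergence from above; both steps use the finite integrals along \<open>\<gamma>\<close>. The infimum stays in \<open>X\<close>
  by the lattice property.
\<close>

section \<open>Bounding increments by integrals of minima\<close>

text \<open>
  By the Henstock lemma, on a fine tagged division the total distance between the integral of \<open>f\<close>
  over a piece \<open>k\<close> and \<open>\<bar>k\<bar> f x\<close>, with \<open>x\<close> the tag of \<open>k\<close>, is small, and the same holds for \<open>g\<close> and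
  for the minimum. At a tag the minimum commutes with the factor \<open>\<bar>k\<bar>\<close>, which turns the smaller of
  the two integral bounds on each piece into a bound by the integral of the minimum.
\<close>

lemma increment_le_integral_min:
  fixes v f g :: "real \<Rightarrow> real"
  assumes ab: "a \<le> b"
    and f: "f integrable_on {a..b}" and g: "g integrable_on {a..b}"
    and m: "(\<lambda>x. min (f x) (g x)) integrable_on {a..b}"
    and vf: "\<And>s t. \<lbrakk>a \<le> s; s \<le> t; t \<le> b\<rbrakk> \<Longrightarrow> \<bar>v t - v s\<bar> \<le> integral {s..t} f"
    and vg: "\<And>s t. \<lbrakk>a \<le> s; s \<le> t; t \<le> b\<rbrakk> \<Longrightarrow> \<bar>v t - v s\<bar> \<le> integral {s..t} g"
  shows "\<bar>v b - v a\<bar> \<le> integral {a..b} (\<lambda>x. min (f x) (g x))"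
proof (rule field_le_epsilon)
  fix e :: real assume "0 < e"
  let ?m = "\<lambda>x. min (f x) (g x)"
  let ?err = "\<lambda>h x k. norm (measure lborel k *\<^sub>R h x - integral k h)"
  have gauge_for: "\<exists>d. gauge d \<and> (\<forall>p. p tagged_partial_division_of cbox a b \<and> d fine p
      \<longrightarrow> (\<Sum>(x, k)\<in>p. ?err h x k) < e / 3)"
    if "h integrable_on {a..b}" for h :: "real \<Rightarrow> real"
  proof -
    have "h integrable_on cbox a b" "0 < e / 3"
      using that \<open>0 < e\<close> by auto
    then show ?thesis
      by (rule Henstock_lemma) blast
  qed
  obtain df where df: "gauge df"
      "\<And>p. p tagged_partial_division_of cbox a b \<Longrightarrow> df fine p \<Longrightarrow> (\<Sum>(x, k)\<in>p. ?err f x k) < e / 3"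
    using gauge_for[OF f] by blast
  obtain dg where dg: "gauge dg"
      "\<And>p. p tagged_partial_division_of cbox a b \<Longrightarrow> dg fine p \<Longrightarrow> (\<Sum>(x, k)\<in>p. ?err g x k) < e / 3"
    using gauge_for[OF g] by blast
  obtain dm where dm: "gauge dm"
      "\<And>p. p tagged_partial_division_of cbox a b \<Longrightarrow> dm fine p \<Longrightarrow> (\<Sum>(x, k)\<in>p. ?err ?m x k) < e / 3"
    using gauge_for[OF m] by blast
  have "gauge (\<lambda>x. df x \<inter> (dg x \<inter> dm x))"
    using df(1) dg(1) dm(1) by (intro gauge_Int)
  then obtain p where p: "p tagged_division_of cbox a b" "(\<lambda>x. df x \<inter> (dg x \<inter> dm x)) fine p"
    by (rule fine_division_exists)
  have part: "p tagged_partial_division_of cbox a b"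
    using p(1) by (simp add: tagged_division_of_def)
  have fine: "df fine p" "dg fine p" "dm fine p"
    using p(2) by (auto simp: fine_def)
  have piece: "\<bar>v (Sup k) - v (Inf k)\<bar> \<le> integral k ?m + ?err ?m x k + ?err f x k + ?err g x k"
    if xk: "(x, k) \<in> p" for x k
  proof -
    obtain s t where k: "k = cbox s t"
      using tagged_division_ofD(4)[OF p(1) xk] by blast
    have "x \<in> k" "k \<subseteq> cbox a b"
      using tagged_division_ofD(2,3)[OF p(1) xk] by auto
    then have st: "a \<le> s" "s \<le> t" "t \<le> b"
      using k by auto
    have ends: "Sup k = t" "Inf k = s" "measure lborel k = t - s"
      using k st by auto
    have "\<bar>v t - v s\<bar> \<le> min (integral k f) (integral k g)"
      using vf[OF st] vg[OF st] k by auto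
    moreover have "measure lborel k *\<^sub>R ?m x = min (measure lborel k *\<^sub>R f x) (measure lborel k *\<^sub>R g x)"
      using st unfolding ends by (simp add: min_mult_distrib_left)
    ultimately show ?thesis
      unfolding ends(1,2) real_norm_def by linarith
  qed
  have "\<bar>v b - v a\<bar> = \<bar>\<Sum>(x, k)\<in>p. v (Sup k) - v (Inf k)\<bar>"
    using additive_tagged_division_1[OF ab, of p v] p(1) by simp
  also have "\<dots> \<le> (\<Sum>(x, k)\<in>p. \<bar>v (Sup k) - v (Inf k)\<bar>)"
    by (rule order_trans[OF sum_abs]) (auto intro!: sum_mono)
  also have "\<dots> \<le> (\<Sum>(x, k)\<in>p. integral k ?m + ?err ?m x k + ?err f x k + ?err g x k)"
    using piece by (intro sum_mono) auto
  also have "\<dots> = (\<Sum>(x, k)\<in>p. integral k ?m) + (\<Sum>(x, k)\<in>p. ?err ?m x k)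
      + (\<Sum>(x, k)\<in>p. ?err f x k) + (\<Sum>(x, k)\<in>p. ?err g x k)"
    by (simp add: case_prod_unfold sum.distrib)
  also have "(\<Sum>(x, k)\<in>p. integral k ?m) = integral {a..b} ?m"
    using integral_combine_tagged_division_topdown[of ?m a b p] m p(1) by simp
  finally show "\<bar>v b - v a\<bar> \<le> integral {a..b} ?m + e"
    using df(2)[OF part fine(1)] dg(2)[OF part fine(2)] dm(2)[OF part fine(3)] by linarith
qed

text \<open>
  The trace on a single curve of what it means to be a weak upper gradient: \<open>v\<close> stands for \<open>u \<circ> \<gamma>\<close>
  and \<open>f\<close> for \<open>g \<circ> \<gamma>\<close>. Every subinterval is included because the minimum of two bounds is treated by
  subdividing. The finite integral excludes bounds that carry no information: if \<open>f\<close> has infinite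
  integral over every nondegenerate interval, it bounds all increments, but \<open>min f g\<close> need not.
\<close>

definition bounds_increments ::
  "real \<Rightarrow> real \<Rightarrow> (real \<Rightarrow> real) \<Rightarrow> (real \<Rightarrow> ennreal) \<Rightarrow> bool" where
  "bounds_increments a b v f \<longleftrightarrow>
    f \<in> borel_measurable (lebesgue_on {a..b}) \<and> (\<integral>\<^sup>+x. f x \<partial>lebesgue_on {a..b}) < \<infinity> \<and>
    (\<forall>s t. a \<le> s \<longrightarrow> s \<le> t \<longrightarrow> t \<le> b \<longrightarrow>
      ennreal \<bar>v t - v s\<bar> \<le> (\<integral>\<^sup>+x. f x \<partial>lebesgue_on {s..t}))"

lemma nn_integral_lebesgue_on_mono_set:
  assumes "S \<in> sets lebesgue" "T \<in> sets lebesgue" "S \<subseteq> T"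
  shows "(\<integral>\<^sup>+x. f x \<partial>lebesgue_on S) \<le> (\<integral>\<^sup>+x. f x \<partial>lebesgue_on T)"
  using assms
  by (auto simp: nn_integral_restrict_space indicator_def intro!: nn_integral_mono)

lemma integrable_enn2real_interval:
  fixes f :: "real \<Rightarrow> ennreal"
  assumes f: "f \<in> borel_measurable (lebesgue_on {a..b})"
    and fin: "(\<integral>\<^sup>+x. f x \<partial>lebesgue_on {a..b}) < \<infinity>"
  shows "integrable (lebesgue_on {a..b}) (\<lambda>x. enn2real (f x))"
    and "(\<integral>\<^sup>+x. f x \<partial>lebesgue_on {a..b}) = ennreal (integral {a..b} (\<lambda>x. enn2real (f x)))"
proof -
  have "AE x in lebesgue_on {a..b}. f x \<noteq> \<infinity>"
    using fin by (intro nn_integral_PInf_AE f) auto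
  then have eq: "(\<integral>\<^sup>+x. f x \<partial>lebesgue_on {a..b})
      = (\<integral>\<^sup>+x. ennreal (enn2real (f x)) \<partial>lebesgue_on {a..b})"
    by (intro nn_integral_cong_AE) (auto simp: less_top)
  show int: "integrable (lebesgue_on {a..b}) (\<lambda>x. enn2real (f x))"
    using f fin eq by (intro integrableI_nonneg) auto
  show "(\<integral>\<^sup>+x. f x \<partial>lebesgue_on {a..b}) = ennreal (integral {a..b} (\<lambda>x. enn2real (f x)))"
    unfolding eq using int by (subst nn_integral_eq_integral) (auto simp: lebesgue_integral_eq_integral)
qed

lemma bounds_increments_subinterval:
  assumes "bounds_increments a b v f" "a \<le> s" "t \<le> b"
  shows "bounds_increments s t v f"
proof -
  have "(\<integral>\<^sup>+x. f x \<partial>lebesgue_on {s..t}) \<le> (\<integral>\<^sup>+x. f x \<partial>lebesgue_on {a..b})"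
    using assms by (intro nn_integral_lebesgue_on_mono_set) auto
  moreover have "f \<in> borel_measurable (lebesgue_on {s..t})"
    using assms by (auto simp: bounds_increments_def intro: measurable_restrict_mono)
  ultimately show ?thesis
    using assms by (auto simp: bounds_increments_def intro: order_le_less_trans)
qed

lemma bounds_increments_min:
  assumes f: "bounds_increments a b v f" and g: "bounds_increments a b v g"
  shows "bounds_increments a b v (\<lambda>x. min (f x) (g x))"
proof -
  have meas: "(\<lambda>x. min (f x) (g x)) \<in> borel_measurable (lebesgue_on {s..t})"
    and fin: "(\<integral>\<^sup>+x. min (f x) (g x) \<partial>lebesgue_on {s..t}) < \<infinity>"
    if "bounds_increments s t v f" "bounds_increments s t v g" for s t
  proof -
    show "(\<lambda>x. min (f x) (g x)) \<in> borel_measurable (lebesgue_on {s..t})"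
      using that by (auto simp: bounds_increments_def)
    have "(\<integral>\<^sup>+x. min (f x) (g x) \<partial>lebesgue_on {s..t}) \<le> (\<integral>\<^sup>+x. f x \<partial>lebesgue_on {s..t})"
      by (intro nn_integral_mono) auto
    then show "(\<integral>\<^sup>+x. min (f x) (g x) \<partial>lebesgue_on {s..t}) < \<infinity>"
      using that by (auto simp: bounds_increments_def intro: order_le_less_trans)
  qed
  have "ennreal \<bar>v t - v s\<bar> \<le> (\<integral>\<^sup>+x. min (f x) (g x) \<partial>lebesgue_on {s..t})"
    if st: "a \<le> s" "s \<le> t" "t \<le> b" for s t
  proof -
    have bf: "bounds_increments s t v f" and bg: "bounds_increments s t v g"
      using f g st by (auto intro: bounds_increments_subinterval)
    let ?f = "\<lambda>x. enn2real (f x)" and ?g = "\<lambda>x. enn2real (g x)"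
    have real_bound: "\<bar>v y - v x\<bar> \<le> integral {x..y} (\<lambda>x. enn2real (h x))"
      if "bounds_increments s t v h" "s \<le> x" "x \<le> y" "y \<le> t" for h x y
    proof -
      have h: "bounds_increments x y v h"
        using that by (auto intro: bounds_increments_subinterval)
      then have hx: "h \<in> borel_measurable (lebesgue_on {x..y})" "(\<integral>\<^sup>+x. h x \<partial>lebesgue_on {x..y}) < \<infinity>"
        by (auto simp: bounds_increments_def)
      have "ennreal \<bar>v y - v x\<bar> \<le> (\<integral>\<^sup>+x. h x \<partial>lebesgue_on {x..y})"
        using h that(3) by (simp add: bounds_increments_def)
      also have "\<dots> = ennreal (integral {x..y} (\<lambda>x. enn2real (h x)))"
        by (rule integrable_enn2real_interval(2)[OF hx])
      finally show ?thesis
        using integrable_enn2real_interval(1)[OF hx]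
        by (subst (asm) ennreal_le_iff) (auto intro!: integral_nonneg integrable_on_lebesgue_on)
    qed
    have int: "integrable (lebesgue_on {s..t}) (\<lambda>x. enn2real (h x))"
      if "h \<in> borel_measurable (lebesgue_on {s..t})" "(\<integral>\<^sup>+x. h x \<partial>lebesgue_on {s..t}) < \<infinity>" for h
      using integrable_enn2real_interval(1) that by blast
    have f_int: "integrable (lebesgue_on {s..t}) ?f" and g_int: "integrable (lebesgue_on {s..t}) ?g"
      using bf bg by (auto simp: bounds_increments_def intro!: int)
    have min_int: "integrable (lebesgue_on {s..t}) (\<lambda>x. min (?f x) (?g x))"
      using f_int g_int by simp
    have inc: "\<bar>v t - v s\<bar> \<le> integral {s..t} (\<lambda>x. min (?f x) (?g x))"
      using f_int g_int min_int st bf bg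
      by (intro increment_le_integral_min real_bound integrable_on_lebesgue_on) auto
    have "AE x in lebesgue_on {s..t}. f x \<noteq> \<infinity>" "AE x in lebesgue_on {s..t}. g x \<noteq> \<infinity>"
      using bf bg by (auto simp: bounds_increments_def intro!: nn_integral_PInf_AE[unfolded infinity_ennreal_def])
    then have "(\<integral>\<^sup>+x. min (f x) (g x) \<partial>lebesgue_on {s..t})
        = (\<integral>\<^sup>+x. ennreal (min (?f x) (?g x)) \<partial>lebesgue_on {s..t})"
      by (intro nn_integral_cong_AE) (auto simp: less_top min_def enn2real_mono dest!: enn2real_le)
    also have "\<dots> = ennreal (integral {s..t} (\<lambda>x. min (?f x) (?g x)))"
      using min_int by (subst nn_integral_eq_integral) (auto simp: lebesgue_integral_eq_integral)
    finally show ?thesis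
      using inc by (simp add: ennreal_leI)
  qed
  with meas[OF f g] fin[OF f g] show ?thesis
    by (auto simp: bounds_increments_def)
qed

text \<open>
  The minima over initial segments of the sequence bound the increments and decrease to the infimum.
  Since they have finite integral, monotone convergence applies from above.
\<close>

lemma bounds_increments_INF:
  assumes f: "\<And>n::nat. bounds_increments a b v (f n)"
  shows "bounds_increments a b v (\<lambda>x. INF n. f n x)"
proof -
  define h where "h n x = (INF k\<in>{..n}. f k x)" for n x
  have h: "bounds_increments a b v (h n)" for n
  proof (induction n)
    case 0
    then show ?case using f[of 0] by (simp add: h_def[abs_def])
  next
    case (Suc n)
    have "h (Suc n) = (\<lambda>x. min (f (Suc n) x) (h n x))"
      by (auto simp: h_def atMost_Suc inf_min)
    then show ?case using bounds_increments_min[OF f Suc] by simp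
  qed
  have dec: "decseq h"
    by (auto simp: monotone_def h_def le_fun_def intro!: INF_superset_mono)
  have INF_h: "(INF n. f n x) = (INF n. h n x)" for x
    unfolding h_def
    by (intro antisym INF_greatest) (auto intro: INF_lower INF_lower2)
  have conv: "(\<integral>\<^sup>+x. (INF n. f n x) \<partial>lebesgue_on {s..t}) = (INF n. \<integral>\<^sup>+x. h n x \<partial>lebesgue_on {s..t})"
    if "a \<le> s" "t \<le> b" for s t
    unfolding INF_h
    using bounds_increments_subinterval[OF h that] dec
    by (intro nn_integral_monotone_convergence_INF_decseq) (auto simp: bounds_increments_def)
  have "(\<integral>\<^sup>+x. (INF n. f n x) \<partial>lebesgue_on {a..b}) \<le> (\<integral>\<^sup>+x. f 0 x \<partial>lebesgue_on {a..b})"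
    by (intro nn_integral_mono INF_lower) auto
  then have "(\<integral>\<^sup>+x. (INF n. f n x) \<partial>lebesgue_on {a..b}) < \<infinity>"
    using f[of 0] by (auto simp: bounds_increments_def intro: order_le_less_trans)
  moreover have "(\<lambda>x. INF n. f n x) \<in> borel_measurable (lebesgue_on {a..b})"
    using f by (intro borel_measurable_INF) (auto simp: bounds_increments_def)
  ultimately show ?thesis
    using h conv by (auto simp: bounds_increments_def intro!: INF_greatest)
qed

section \<open>Least elements modulo null sets\<close>

text \<open>
  For an integrable weight \<open>w > 0\<close>, the functional \<open>J g = \<integral> w / (1 + g)\<close> is finite, also for
  functions with infinite values, and it strictly increases when \<open>g\<close> decreases on a set of positive
  measure. Its supremum over \<open>G\<close> is attained at the infimum \<open>g\<close> of a maximizing sequence. For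
  \<open>h \<in> G\<close> the function \<open>min g h\<close> is again in \<open>G\<close>, and since \<open>J\<close> cannot exceed its maximum there,
  this minimum agrees with \<open>g\<close> almost everywhere.
\<close>

lemma (in sigma_finite_measure) ex_AE_least:
  fixes G :: "('a \<Rightarrow> ennreal) set"
  assumes "G \<noteq> {}" and meas: "G \<subseteq> borel_measurable M"
    and INF_closed: "\<And>f. (\<And>n::nat. f n \<in> G) \<Longrightarrow> (\<lambda>x. INF n. f n x) \<in> G"
  shows "\<exists>g\<in>G. \<forall>h\<in>G. AE x in M. g x \<le> h x"
proof -
  obtain w where w[measurable]: "w \<in> borel_measurable M" and w_fin: "integral\<^sup>N M w \<noteq> \<infinity>"
    and w_pos: "\<And>x. x \<in> space M \<Longrightarrow> 0 < w x \<and> w x < \<infinity>"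
    using Ex_finite_integrable_function by blast
  define J where "J g = (\<integral>\<^sup>+x. w x * inverse (1 + g x) \<partial>M)" for g
  have inverse_anti: "inverse (1 + y) \<le> inverse (1 + z)" if "z \<le> y" for y z :: ennreal
    using that by (cases y; cases z)
      (auto simp: inverse_ennreal top_unique simp flip: ennreal_1 ennreal_plus intro!: ennreal_leI)
  have inverse_anti_iff: "z \<le> y" if "inverse (1 + y) \<le> inverse (1 + z)" for y z :: ennreal
    using that by (cases y; cases z)
      (auto simp: inverse_ennreal ennreal_add_eq_top simp flip: ennreal_1 ennreal_plus)
  have J_mono: "J h \<le> J g" if "\<And>x. g x \<le> h x" for g h
    unfolding J_def using that by (intro nn_integral_mono mult_left_mono inverse_anti) auto
  have J_fin: "J g < \<infinity>" for g
  proof -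
    have "w x * inverse (1 + g x) \<le> w x" for x
      using mult_left_mono[OF inverse_anti[of 0 "g x"], of "w x"] by simp
    then have "J g \<le> integral\<^sup>N M w"
      unfolding J_def by (intro nn_integral_mono)
    with w_fin show ?thesis
      by (auto simp: less_top intro: order_le_less_trans)
  qed
  obtain j where j: "range j \<subseteq> J ` G" "Sup (J ` G) = (SUP n::nat. j n)"
    using ennreal_Sup_countable_SUP[of "J ` G"] \<open>G \<noteq> {}\<close> by blast
  then have "\<forall>n. \<exists>g\<in>G. j n = J g"
    by auto
  then obtain f where f: "\<And>n. f n \<in> G" "\<And>n. j n = J (f n)"
    by metis
  define g where "g x = (INF n. f n x)" for x
  have gG: "g \<in> G"
    using INF_closed[OF f(1)] by (simp add: g_def[abs_def])
  have J_max: "J h \<le> J g" if "h \<in> G" for h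
  proof -
    have "J h \<le> Sup (J ` G)"
      using that by (intro Sup_upper) auto
    also have "\<dots> \<le> J g"
      unfolding j(2) f(2) by (intro SUP_least J_mono) (auto simp: g_def intro: INF_lower)
    finally show ?thesis .
  qed
  have "AE x in M. g x \<le> h x" if "h \<in> G" for h
  proof -
    define k where "k x = min (g x) (h x)" for x
    \<comment> \<open>The minimum of two functions is the infimum of a sequence with two values.\<close>
    have "(\<lambda>x. INF n::nat. (if n = 0 then g else h) x) \<in> G"
      using gG that by (intro INF_closed) auto
    moreover have "(INF n::nat. (if n = 0 then g else h) x) = k x" for x
      unfolding k_def
      by (intro antisym INF_greatest) (auto intro: INF_lower2[of 0] INF_lower2[of 1])
    ultimately have "k \<in> G"
      by simp
    then have [measurable]: "k \<in> borel_measurable M" "g \<in> borel_measurable M"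
      using gG meas by auto
    have le: "w x * inverse (1 + g x) \<le> w x * inverse (1 + k x)" for x
      by (intro mult_left_mono inverse_anti) (auto simp: k_def)
    have "(\<integral>\<^sup>+x. w x * inverse (1 + k x) - w x * inverse (1 + g x) \<partial>M) = J k - J g"
      unfolding J_def using J_fin[of g] le
      by (intro nn_integral_diff) (auto simp: J_def)
    also have "\<dots> = 0"
      using J_max[OF \<open>k \<in> G\<close>] J_fin[of k] by (simp add: diff_eq_0_iff_ennreal)
    finally have "AE x in M. w x * inverse (1 + k x) - w x * inverse (1 + g x) = 0"
      by (subst (asm) nn_integral_0_iff_AE) auto
    then show ?thesis
    proof (rule AE_mp, intro AE_I2 impI)
      fix x assume x: "x \<in> space M" and "w x * inverse (1 + k x) - w x * inverse (1 + g x) = 0"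
      then have "w x * inverse (1 + k x) \<le> w x * inverse (1 + g x)"
        by (simp add: diff_eq_0_iff_ennreal)
      then have "inverse (1 + k x) \<le> inverse (1 + g x)"
        using w_pos[OF x] by (subst (asm) ennreal_mult_le_mult_iff) auto
      then have "g x \<le> k x"
        by (rule inverse_anti_iff)
      then show "g x \<le> h x"
        by (simp add: k_def)
    qed
  qed
  with gG show ?thesis
    by blast
qed

section \<open>Borel majorants\<close>

text \<open>
  Regularity gives a set \<open>D\<close> of the same measure, which makes \<open>D - A\<close> null only if that measure is
  finite; hence the decomposition into pieces of finite measure.
\<close>

lemma (in borel_regular_metric_measure) borel_hull:
  assumes A: "A \<in> sets M"
  shows "\<exists>D\<in>sets borel. A \<subseteq> D \<and> D - A \<in> null_sets M"
proof -
  obtain F :: "nat \<Rightarrow> 'a set" where F: "range F \<subseteq> sets M" "(\<Union>i. F i) = space M"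
      "\<And>i. emeasure M (F i) \<noteq> \<infinity>"
    using sigma_finite by blast
  have FA: "A \<inter> F i \<in> sets M" for i
    using A F(1) by auto
  have fin: "emeasure M (A \<inter> F i) < \<infinity>" for i
    using emeasure_mono[of "A \<inter> F i" "F i" M] F(1) F(3)[of i]
    by (auto simp: less_top range_subsetD intro: order_le_less_trans)
  have "\<forall>i. \<exists>D\<in>sets borel. A \<inter> F i \<subseteq> D \<and> emeasure M D = emeasure M (A \<inter> F i)"
    using borel_regular FA by blast
  then obtain D where D: "\<And>i. D i \<in> sets borel" "\<And>i. A \<inter> F i \<subseteq> D i"
      "\<And>i. emeasure M (D i) = emeasure M (A \<inter> F i)"
    by metis
  have DM: "D i \<in> sets M" for i
    using D(1) borel_measurable_sets by blast
  have "D i - (A \<inter> F i) \<in> null_sets M" for i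
    using emeasure_Diff[of M "A \<inter> F i" "D i"] FA DM D fin[of i] by (auto simp: null_sets_def)
  then have "(\<Union>i. D i - (A \<inter> F i)) \<in> null_sets M"
    by (intro null_sets_UN) auto
  then have "(\<Union>i. D i) - A \<in> null_sets M"
    by (rule null_sets_subset) (use A DM in auto)
  moreover have "A \<subseteq> (\<Union>i. D i)"
  proof
    fix x assume "x \<in> A"
    moreover obtain i where "x \<in> F i"
      using F(2) space_UNIV by blast
    ultimately show "x \<in> (\<Union>i. D i)" using D(2) by blast
  qed
  ultimately show ?thesis
    using D(1) by (intro bexI[of _ "\<Union>i. D i"]) auto
qed

text \<open>
  Only Borel functions are admissible in the modulus, so a measurable \<open>g\<close> has to be replaced by a
  Borel function. It is built from Borel hulls of the superlevel sets of \<open>g\<close> at rational levels.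
\<close>

lemma (in borel_regular_metric_measure) borel_majorant:
  fixes g :: "'a \<Rightarrow> ennreal"
  assumes [measurable]: "g \<in> borel_measurable M"
  shows "\<exists>h\<in>borel_measurable borel. (\<forall>x. g x \<le> h x) \<and> (AE x in M. h x = g x)"
proof -
  let ?A = "\<lambda>q::rat. {x \<in> space M. ennreal (of_rat q) < g x}"
  have "\<forall>q. \<exists>D\<in>sets borel. ?A q \<subseteq> D \<and> D - ?A q \<in> null_sets M"
    by (intro allI borel_hull) measurable
  then have "\<exists>D. \<forall>q. D q \<in> sets borel \<and> ?A q \<subseteq> D q \<and> D q - ?A q \<in> null_sets M"
    by (intro choice) auto
  then obtain D where D[measurable]: "\<And>q. D q \<in> sets borel" and sub: "\<And>q. ?A q \<subseteq> D q"
    and null: "\<And>q. D q - ?A q \<in> null_sets M"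
    by auto
  define h where "h x = (SUP q. ennreal (of_rat q) * indicator (D q) x)" for x
  have "h \<in> borel_measurable borel"
    unfolding h_def[abs_def] by measurable
  moreover have le: "g x \<le> h x" for x
  proof (rule dense_le)
    fix y assume "y < g x"
    then obtain q :: rat where q: "y < ennreal (of_rat q)" "ennreal (of_rat q) < g x"
      using ennreal_rat_dense by blast
    then have "x \<in> D q"
      using sub[of q] by (auto simp: space_UNIV)
    then have "ennreal (of_rat q) * indicator (D q) x = ennreal (of_rat q)"
      by simp
    moreover have "ennreal (of_rat q) * indicator (D q) x \<le> h x"
      unfolding h_def by (intro SUP_upper) simp
    ultimately show "y \<le> h x"
      using q(1) by simp
  qed
  moreover have "AE x in M. h x = g x"
  proof -
    have "AE x in M. \<forall>q. x \<notin> D q - ?A q"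
      unfolding AE_all_countable using AE_not_in[OF null] by blast
    then show ?thesis
    proof (rule AE_mp, intro AE_I2 impI)
      fix x assume "\<forall>q. x \<notin> D q - ?A q"
      then have "h x \<le> g x"
        unfolding h_def by (intro SUP_least) (auto simp: indicator_def)
      with le show "h x = g x" by (intro antisym)
    qed
  qed
  ultimately show ?thesis by blast
qed

section \<open>Subcurves of arc length parametrized curves\<close>

lemma curve_length_upper:
  assumes "mono_on {..n} t" "t 0 = a" "t n = b"
  shows "(\<Sum>i<n. ennreal (dist (\<gamma> (t i)) (\<gamma> (t (Suc i))))) \<le> curve_length \<gamma> a b"
  using assms unfolding curve_length_def by (intro Sup_upper) blast

lemma curve_length_least:
  assumes "\<And>n t. mono_on {..n} t \<Longrightarrow> t 0 = a \<Longrightarrow> t n = b \<Longrightarrow>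
    (\<Sum>i<n. ennreal (dist (\<gamma> (t i)) (\<gamma> (t (Suc i))))) \<le> L"
  shows "curve_length \<gamma> a b \<le> L"
  using assms unfolding curve_length_def by (intro Sup_least) blast

text \<open>
  A partition of \<open>{a..c}\<close> is cut at \<open>b\<close> by truncation: \<open>min t b\<close> and \<open>max t b\<close> are partitions of the
  two parts with the same number of points, so no point has to be inserted. Only the
  step that crosses \<open>b\<close> uses the triangle inequality.
\<close>

lemma curve_length_subadditive:
  assumes "a \<le> b" "b \<le> c"
  shows "curve_length \<gamma> a c \<le> curve_length \<gamma> a b + curve_length \<gamma> b c"
proof (rule curve_length_least)
  fix n :: nat and t :: "nat \<Rightarrow> real"
  assume t: "mono_on {..n} t" "t 0 = a" "t n = c"
  let ?d = "\<lambda>t i. ennreal (dist (\<gamma> (t i)) (\<gamma> (t (Suc i))))"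
  let ?l = "\<lambda>i. min (t i) b" and ?r = "\<lambda>i. max (t i) b"
  have step: "?d t i \<le> ?d ?l i + ?d ?r i" if "i < n" for i
  proof -
    have "t i \<le> t (Suc i)"
      using t(1) that by (auto intro: mono_onD)
    then consider "t (Suc i) \<le> b" | "b \<le> t i" | "t i \<le> b" "b \<le> t (Suc i)"
      by linarith
    then show ?thesis
    proof cases
      case 3
      then show ?thesis
        by (simp add: ennreal_leI dist_triangle flip: ennreal_plus)
    qed (use \<open>t i \<le> t (Suc i)\<close> in \<open>simp_all add: min_absorb1 max_absorb1 min_absorb2 max_absorb2\<close>)
  qed
  have "(\<Sum>i<n. ?d t i) \<le> (\<Sum>i<n. ?d ?l i) + (\<Sum>i<n. ?d ?r i)"
    unfolding sum.distrib[symmetric] using step by (intro sum_mono) auto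
  also have "\<dots> \<le> curve_length \<gamma> a b + curve_length \<gamma> b c"
    using t assms
    by (intro add_mono curve_length_upper)
      (auto simp: mono_on_def min.coboundedI1 max.coboundedI1 intro: min.mono max.mono)
  finally show "(\<Sum>i<n. ?d t i) \<le> curve_length \<gamma> a b + curve_length \<gamma> b c" .
qed

lemma curve_length_superadditive:
  assumes ab: "a \<le> b" and bc: "b \<le> c"
  shows "curve_length \<gamma> a b + curve_length \<gamma> b c \<le> curve_length \<gamma> a c"
proof -
  let ?d = "\<lambda>t i. ennreal (dist (\<gamma> (t i)) (\<gamma> (t (Suc i))))"
  have concat: "(\<Sum>i<m. ?d s i) + (\<Sum>i<n. ?d t i) \<le> curve_length \<gamma> a c"
    if s: "mono_on {..m} s" "s 0 = a" "s m = b" and t: "mono_on {..n} t" "t 0 = b" "t n = c"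
    for m n s t
  proof -
    define r where "r i = (if i \<le> m then s i else t (i - m))" for i
    have r_shift: "r (m + i) = t i" for i
      using s(3) t(2) by (auto simp: r_def)
    have "(\<Sum>i<m + n. ?d r i) = (\<Sum>i<m. ?d r i) + (\<Sum>i<n. ?d r (m + i))"
      by (induction n) (auto simp: add.assoc)
    also have "(\<Sum>i<m. ?d r i) = (\<Sum>i<m. ?d s i)"
      by (intro sum.cong) (auto simp: r_def)
    also have "(\<Sum>i<n. ?d r (m + i)) = (\<Sum>i<n. ?d t i)"
      using r_shift by (intro sum.cong) (auto simp flip: add_Suc_right)
    finally have eq: "(\<Sum>i<m + n. ?d r i) = (\<Sum>i<m. ?d s i) + (\<Sum>i<n. ?d t i)" .
    have "r i \<le> r j" if ij: "i \<le> j" "j \<le> m + n" for i j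
    proof (cases "i \<le> m \<and> m < j")
      case True
      have "s i \<le> b"
        using s True by (metis atMost_iff mono_onD order_refl)
      also have "b \<le> t (j - m)"
        using t ij True by (metis atMost_iff mono_onD le0 le_diff_conv add.commute)
      finally show ?thesis
        using True by (simp add: r_def)
    next
      case False
      then show ?thesis
        using ij s(1) t(1) by (auto simp: r_def intro!: mono_onD[of "{..m}" s] mono_onD[of "{..n}" t])
    qed
    then have "mono_on {..m + n} r"
      by (auto simp: mono_on_def)
    moreover have "r 0 = a" "r (m + n) = c"
      using s(2) t(3) r_shift[of n] by (auto simp: r_def)
    ultimately have "(\<Sum>i<m + n. ?d r i) \<le> curve_length \<gamma> a c"
      by (rule curve_length_upper)
    with eq show ?thesis by simp
  qed
  \<comment> \<open>An addend moves into a supremum only if the index set is nonempty.\<close>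
  let ?S = "\<lambda>a b. {\<Sum>i<n. ?d t i | n t. mono_on {..n} t \<and> t 0 = a \<and> t n = b}"
  have nonempty: "?S x y \<noteq> {}" if "x \<le> y" for x y
  proof -
    have "mono_on {..1} (\<lambda>i::nat. if i = 0 then x else y)"
      using that by (auto simp: mono_on_def)
    then show ?thesis by fastforce
  qed
  have "curve_length \<gamma> a b + curve_length \<gamma> b c = (SUP x\<in>?S a b. x + curve_length \<gamma> b c)"
    using ennreal_SUP_add_left[OF nonempty[OF ab], of "\<lambda>x. x"] by (simp add: curve_length_def)
  also have "\<dots> = (SUP x\<in>?S a b. SUP y\<in>?S b c. x + y)"
    using ennreal_SUP_add_right[OF nonempty[OF bc], of _ "\<lambda>y. y"] by (simp add: curve_length_def)
  also have "\<dots> \<le> curve_length \<gamma> a c"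
    using concat by (intro SUP_least) blast
  finally show ?thesis .
qed

lemma curve_length_shift: "curve_length (\<lambda>r. \<gamma> (s + r)) a b = curve_length \<gamma> (s + a) (s + b)"
proof -
  have le: "curve_length (\<lambda>r. \<gamma> (s + r)) a b \<le> curve_length \<gamma> (s + a) (s + b)" for \<gamma> s a b
  proof (rule curve_length_least)
    fix n :: nat and t :: "nat \<Rightarrow> real"
    assume "mono_on {..n} t" "t 0 = a" "t n = b"
    then show "(\<Sum>i<n. ennreal (dist (\<gamma> (s + t i)) (\<gamma> (s + t (Suc i))))) \<le> curve_length \<gamma> (s + a) (s + b)"
      by (intro curve_length_upper[of n "\<lambda>i. s + t i"]) (auto simp: mono_on_def)
  qed
  show ?thesis
    using le[of \<gamma> s a b] le[of "\<lambda>r. \<gamma> (s + r)" "- s" "s + a" "s + b"] by (auto intro: antisym)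
qed

definition subcurve :: "'a curve \<Rightarrow> real \<Rightarrow> real \<Rightarrow> 'a curve" where
  "subcurve p s t = ((\<lambda>r. fst p (s + r)), t - s)"

text \<open>
  Additivity of length gives the piece of \<open>\<gamma>\<close> over \<open>{s..s + r}\<close> length \<open>(s + r) - s = r\<close>, so a shifted arc
  length parametrization is again one by arc length.
\<close>

lemma subcurve_in_curves:
  assumes p: "p \<in> curves" and st: "0 \<le> s" "s < t" "t \<le> snd p"
  shows "subcurve p s t \<in> curves"
proof -
  obtain \<gamma> l where pl: "p = (\<gamma>, l)" by fastforce
  have cont: "continuous_on {0..l} \<gamma>"
    and len: "\<And>r. 0 \<le> r \<Longrightarrow> r \<le> l \<Longrightarrow> curve_length \<gamma> 0 r = ennreal r"
    using p by (auto simp: pl curves_def)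
  have "continuous_on {0..t - s} (\<lambda>r. \<gamma> (s + r))"
    using st pl by (intro continuous_on_compose2[OF cont] continuous_intros) auto
  moreover have "curve_length (\<lambda>r. \<gamma> (s + r)) 0 r = ennreal r" if r: "0 \<le> r" "r \<le> t - s" for r
  proof -
    have "ennreal (s + r) = ennreal s + curve_length \<gamma> s (s + r)"
      using curve_length_subadditive[of 0 s "s + r" \<gamma>] curve_length_superadditive[of 0 s "s + r" \<gamma>]
        len[of s] len[of "s + r"] st r pl by (auto intro: antisym)
    then have "ennreal s + ennreal r = ennreal s + curve_length \<gamma> s (s + r)"
      using st r by (simp add: ennreal_plus)
    then show ?thesis
      using curve_length_shift[where \<gamma> = \<gamma> and s = s and a = 0 and b = r] by (simp add: ennreal_add_left_cancel)
  qed
  ultimately show ?thesis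
    using st by (auto simp: subcurve_def pl curves_def)
qed

lemma line_integral_subcurve:
  assumes g: "(\<lambda>r. g (fst p r)) \<in> borel_measurable (lebesgue_on {0..snd p})"
    and st: "0 \<le> s" "s \<le> t" "t \<le> snd p"
  shows "line_integral (subcurve p s t) g = (\<integral>\<^sup>+r. g (fst p r) \<partial>lebesgue_on {s..t})"
proof -
  let ?F = "\<lambda>r. g (fst p r) * indicator {s..t} r"
  have "(\<lambda>r. g (fst p r)) \<in> borel_measurable (lebesgue_on {s..t})"
    using g st by (auto intro: measurable_restrict_mono)
  then have "?F \<in> borel_measurable lebesgue"
    by (subst (asm) borel_measurable_restrict_space_iff_ennreal) auto
  then have "(\<integral>\<^sup>+r. ?F r \<partial>lebesgue) = (\<integral>\<^sup>+r. ?F (s + r) \<partial>lebesgue)"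
    using nn_integral_real_affine_lebesgue[of ?F 1 s] by simp
  also have "\<dots> = (\<integral>\<^sup>+r. g (fst p (s + r)) * indicator {0..t - s} r \<partial>lebesgue)"
    by (intro nn_integral_cong) (auto simp: indicator_def)
  finally show ?thesis
    by (simp add: line_integral_def subcurve_def nn_integral_restrict_space)
qed

lemma borel_measurable_along_curve:
  assumes h: "h \<in> borel_measurable borel" and p: "p \<in> curves"
  shows "(\<lambda>r. h (fst p r)) \<in> borel_measurable (lebesgue_on {0..snd p})"
proof -
  have "fst p \<in> borel_measurable (lebesgue_on {0..snd p})"
    using p by (intro continuous_imp_measurable_on_sets_lebesgue) (auto simp: curves_def)
  then show ?thesis
    using measurable_compose[OF _ h] by blast
qed

section \<open>Curve families of modulus zero\<close>

lemma modulus_upper: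
  assumes "\<rho> \<in> borel_measurable borel" "\<And>p. p \<in> \<Gamma> \<Longrightarrow> 1 \<le> line_integral p \<rho>"
  shows "modulus N \<Gamma> \<le> N (\<lambda>x. enn2ereal (\<rho> x))"
  using assms unfolding modulus_def by (intro Inf_lower) blast

text \<open>
  A function admissible for \<open>\<Delta>\<close> is admissible for \<open>\<Gamma>\<close>. With \<open>q = p\<close> this is monotonicity under
  inclusion; with \<open>q\<close> a subcurve of \<open>p\<close> it shows that having an exceptional subcurve is exceptional.
\<close>

lemma modulus_mono_subcurves:
  assumes "\<And>p \<rho>. p \<in> \<Gamma> \<Longrightarrow> \<rho> \<in> borel_measurable borel \<Longrightarrow>
    \<exists>q\<in>\<Delta>. line_integral q \<rho> \<le> line_integral p \<rho>"
  shows "modulus N \<Gamma> \<le> modulus N \<Delta>"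
  unfolding modulus_def
proof (intro Inf_superset_mono, clarify)
  fix \<rho> :: "'a \<Rightarrow> ennreal"
  assume \<rho>: "\<rho> \<in> borel_measurable borel" "\<forall>q\<in>\<Delta>. 1 \<le> line_integral q \<rho>"
  then have "\<forall>p\<in>\<Gamma>. 1 \<le> line_integral p \<rho>"
    using assms order_trans by blast
  with \<rho>(1) show "\<exists>\<rho>'. N (\<lambda>x. enn2ereal (\<rho> x)) = N (\<lambda>x. enn2ereal (\<rho>' x)) \<and>
      \<rho>' \<in> borel_measurable borel \<and> (\<forall>p\<in>\<Gamma>. 1 \<le> line_integral p \<rho>')"
    by blast
qed

lemma ae_curve_mono:
  assumes "ae_curve N P" "\<And>p. p \<in> curves \<Longrightarrow> P p \<Longrightarrow> Q p"
  shows "ae_curve N Q"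
proof -
  have "modulus N {p \<in> curves. \<not> Q p} \<le> modulus N {p \<in> curves. \<not> P p}"
    using assms(2) by (intro modulus_mono_subcurves) auto
  then show ?thesis
    using assms(1) by (simp add: ae_curve_def)
qed

lemma ae_curve_subcurves:
  assumes "ae_curve N P"
  shows "ae_curve N (\<lambda>p. \<forall>s t. 0 \<le> s \<longrightarrow> s < t \<longrightarrow> t \<le> snd p \<longrightarrow> P (subcurve p s t))"
    (is "ae_curve N ?Q")
proof -
  have "modulus N {p \<in> curves. \<not> ?Q p} \<le> modulus N {p \<in> curves. \<not> P p}"
  proof (rule modulus_mono_subcurves)
    fix p :: "'a curve" and \<rho> :: "'a \<Rightarrow> ennreal"
    assume "p \<in> {p \<in> curves. \<not> ?Q p}" and \<rho>: "\<rho> \<in> borel_measurable borel"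
    then obtain s t where p: "p \<in> curves" and st: "0 \<le> s" "s < t" "t \<le> snd p"
        and nP: "\<not> P (subcurve p s t)"
      by auto
    have "line_integral (subcurve p s t) \<rho> = (\<integral>\<^sup>+r. \<rho> (fst p r) \<partial>lebesgue_on {s..t})"
      using st by (intro line_integral_subcurve borel_measurable_along_curve[OF \<rho> p]) auto
    also have "\<dots> \<le> line_integral p \<rho>"
      unfolding line_integral_def using st by (intro nn_integral_lebesgue_on_mono_set) auto
    finally show "\<exists>q\<in>{p \<in> curves. \<not> P p}. line_integral q \<rho> \<le> line_integral p \<rho>"
      using nP subcurve_in_curves[OF p st] by blast
  qed
  then show ?thesis
    using assms by (simp add: ae_curve_def)
qed

context quasi_banach_function_lattice
begin

lemma borel_measurable_imp_measurable: "f \<in> borel_measurable borel \<Longrightarrow> f \<in> borel_measurable M"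
  using measurable_mono[of borel borel borel M] borel_measurable_sets space_UNIV by auto

text \<open>
  The sum of functions admissible for the single families is admissible for the union. Its norm is
  controlled by the Riesz-Fischer property, whose growing factors \<open>c ^ Suc n\<close> are harmless because the
  \<open>n\<close>-th norm can be chosen as small as required.
\<close>

lemma modulus_UN_null:
  assumes null: "\<And>n::nat. modulus N (\<Gamma> n) = 0"
  shows "modulus N (\<Union>n. \<Gamma> n) = 0"
proof -
  have "modulus N (\<Union>n. \<Gamma> n) \<le> 0 + ennreal e" if "0 < e" for e
  proof -
    define \<delta> where "\<delta> n = e * (1 / 2) ^ Suc n / c ^ Suc n" for n :: nat
    have c: "0 < c"
      using concavity_ge_1 by simp
    have "\<exists>\<rho>. \<rho> \<in> borel_measurable borel \<and> (\<forall>p\<in>\<Gamma> n. 1 \<le> line_integral p \<rho>) \<and>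
        N (\<lambda>x. enn2ereal (\<rho> x)) < ennreal (\<delta> n)" for n
    proof -
      have "modulus N (\<Gamma> n) < ennreal (\<delta> n)"
        using null[of n] \<open>0 < e\<close> c by (simp add: \<delta>_def)
      then show ?thesis
        unfolding modulus_def by (subst (asm) Inf_less_iff) blast
    qed
    then obtain \<rho> where \<rho>[measurable]: "\<And>n. \<rho> n \<in> borel_measurable borel"
      and adm: "\<And>n p. p \<in> \<Gamma> n \<Longrightarrow> 1 \<le> line_integral p (\<rho> n)"
      and small: "\<And>n. N (\<lambda>x. enn2ereal (\<rho> n x)) < ennreal (\<delta> n)"
      by metis
    define R where "R x = (\<Sum>n. \<rho> n x)" for x
    have R[measurable]: "R \<in> borel_measurable borel"
      unfolding R_def[abs_def] by measurable
    have "\<rho> n x \<le> R x" for n x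
      using sum_le_suminf[of "\<lambda>n. \<rho> n x" "{n}"] by (simp add: R_def)
    then have "line_integral p (\<rho> n) \<le> line_integral p R" for p n
      unfolding line_integral_def by (intro nn_integral_mono)
    then have "modulus N (\<Union>n. \<Gamma> n) \<le> N (\<lambda>x. enn2ereal (R x))"
      using adm by (intro modulus_upper R) (blast intro: order_trans)
    also have "\<dots> \<le> (\<Sum>n. ennreal c ^ Suc n * N (\<lambda>x. enn2ereal (\<rho> n x)))"
    proof (rule riesz_fischer)
      show "AE x in M. (\<lambda>n. enn2ereal (\<rho> n x)) sums enn2ereal (R x)"
        by (simp add: R_def summable_sums)
    qed (auto intro!: borel_measurable_imp_measurable)
    also have "\<dots> \<le> (\<Sum>n. ennreal (e * (1 / 2) ^ Suc n))"
    proof (intro suminf_le summableI)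
      fix n
      have "ennreal c ^ Suc n * N (\<lambda>x. enn2ereal (\<rho> n x)) \<le> ennreal (c ^ Suc n) * ennreal (\<delta> n)"
        using small[of n] c by (simp only: ennreal_power) (intro mult_left_mono; simp add: less_imp_le)
      also have "\<dots> = ennreal (e * (1 / 2) ^ Suc n)"
        using c \<open>0 < e\<close> by (subst ennreal_mult[symmetric]) (auto simp: \<delta>_def)
      finally show "ennreal c ^ Suc n * N (\<lambda>x. enn2ereal (\<rho> n x)) \<le> ennreal (e * (1 / 2) ^ Suc n)" .
    qed
    also have "\<dots> = ennreal (e * 1)"
      using \<open>0 < e\<close> by (intro suminf_ennreal_eq sums_mult power_half_series) auto
    finally show ?thesis by simp
  qed
  then have "modulus N (\<Union>n. \<Gamma> n) \<le> 0"
    by (rule ennreal_le_epsilon)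
  then show ?thesis by simp
qed

lemma ae_curve_all:
  assumes "\<And>n::nat. ae_curve N (P n)"
  shows "ae_curve N (\<lambda>p. \<forall>n. P n p)"
proof -
  have "{p \<in> curves. \<not> (\<forall>n. P n p)} = (\<Union>n. {p \<in> curves. \<not> P n p})"
    by auto
  then show ?thesis
    using assms modulus_UN_null[of "\<lambda>n. {p \<in> curves. \<not> P n p}"] by (simp add: ae_curve_def)
qed

lemma ae_curve_conj:
  assumes "ae_curve N P" "ae_curve N Q"
  shows "ae_curve N (\<lambda>p. P p \<and> Q p)"
proof -
  have "ae_curve N (\<lambda>p. \<forall>n::nat. if n = 0 then P p else Q p)"
  proof (rule ae_curve_all)
    show "ae_curve N (\<lambda>p. if n = 0 then P p else Q p)" for n :: nat
      using assms by (cases "n = 0") simp_all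
  qed
  then show ?thesis
    by (rule ae_curve_mono) (metis zero_neq_one)
qed

lemma ae_curve_if_all_curves:
  assumes "\<And>p. p \<in> curves \<Longrightarrow> P p"
  shows "ae_curve N P"
proof -
  have "modulus N {p \<in> curves. \<not> P p} \<le> N (\<lambda>x. enn2ereal 0)"
    using assms by (intro modulus_upper) auto
  also have "\<dots> = 0"
    by (subst norm_zero_iff) (auto simp: zero_ennreal.rep_eq)
  finally show ?thesis by (simp add: ae_curve_def)
qed

text \<open>
  If \<open>g\<close> has infinite integral along a curve, then every positive multiple of a Borel majorant of \<open>g\<close> is
  admissible for this curve. A majorant that agrees with \<open>g\<close> almost everywhere has the finite norm of
  \<open>g\<close>, so the norms of its small multiples are arbitrarily small.
\<close>

lemma ae_curve_line_integral_finite: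
  assumes g[measurable]: "g \<in> borel_measurable M" and fin: "N (\<lambda>x. enn2ereal (g x)) < \<infinity>"
  shows "ae_curve N (\<lambda>p. line_integral p g < \<infinity>)"
proof -
  obtain h where h[measurable]: "h \<in> borel_measurable borel"
    and le: "\<And>x. g x \<le> h x" and eq: "AE x in M. h x = g x"
    using borel_majorant[OF g] by blast
  have hM[measurable]: "h \<in> borel_measurable M"
    by (rule borel_measurable_imp_measurable) fact
  have "N (\<lambda>x. enn2ereal (h x)) \<le> N (\<lambda>x. enn2ereal (g x))"
    using eq by (intro lattice_property) auto
  with fin obtain K where K: "0 \<le> K" "N (\<lambda>x. enn2ereal (h x)) = ennreal K"
    by (metis infinity_ennreal_def less_top_ennreal order_le_less_trans)
  let ?\<Gamma> = "{p \<in> curves. \<not> line_integral p g < \<infinity>}"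
  have "modulus N ?\<Gamma> \<le> 0 + ennreal e" if "0 < e" for e
  proof -
    \<comment> \<open>The denominator is \<open>K + 1\<close> rather than \<open>K\<close> because \<open>K\<close> may vanish.\<close>
    define a where "a = e / (K + 1)"
    have a: "0 < a"
      using that K by (simp add: a_def)
    have "1 \<le> line_integral p (\<lambda>x. ennreal a * h x)" if p: "p \<in> ?\<Gamma>" for p
    proof -
      have "line_integral p g \<le> line_integral p h"
        unfolding line_integral_def by (intro nn_integral_mono le)
      then have "line_integral p h = \<infinity>"
        using p by (auto simp: top_unique simp flip: less_top)
      moreover have "line_integral p (\<lambda>x. ennreal a * h x) = ennreal a * line_integral p h"
        unfolding line_integral_def
        using p by (intro nn_integral_cmult borel_measurable_along_curve) auto
      ultimately show ?thesis
        using a by (simp add: ennreal_mult_top)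
    qed
    then have "modulus N ?\<Gamma> \<le> N (\<lambda>x. enn2ereal (ennreal a * h x))"
      by (intro modulus_upper) auto
    also have "\<dots> = N (\<lambda>x. ereal a * enn2ereal (h x))"
      using a by (simp add: times_ennreal.rep_eq)
    also have "\<dots> = ennreal a * ennreal K"
      using a K by (subst norm_scale) auto
    also have "\<dots> \<le> ennreal e"
      using a K that by (subst ennreal_mult[symmetric]) (auto simp: a_def field_simps intro!: ennreal_leI)
    finally show ?thesis by simp
  qed
  then have "modulus N ?\<Gamma> \<le> 0"
    by (rule ennreal_le_epsilon)
  then show ?thesis
    by (simp add: ae_curve_def)
qed

section \<open>Countable infima of weak upper gradients\<close>

definition lattice_weak_upper_gradients :: "('a \<Rightarrow> ereal) \<Rightarrow> ('a \<Rightarrow> ennreal) set" where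
  "lattice_weak_upper_gradients u =
    {g. weak_upper_gradient M N u g \<and> (\<lambda>x. enn2ereal (g x)) \<in> lattice_space M N}"

lemma upper_gradient_imp_weak:
  assumes "upper_gradient u g"
  shows "weak_upper_gradient M N u g"
  using assms unfolding upper_gradient_def weak_upper_gradient_def
  by (auto intro!: ae_curve_if_all_curves borel_measurable_imp_measurable intro: borel_measurable_along_curve)

lemma gradient_ineq_subcurve_iff:
  assumes "(\<lambda>r. g (fst p r)) \<in> borel_measurable (lebesgue_on {0..snd p})"
    and "0 \<le> s" "s \<le> t" "t \<le> snd p"
  shows "gradient_ineq u g (subcurve p s t) \<longleftrightarrow>
    \<bar>u (fst p s) - u (fst p t)\<bar> \<le> enn2ereal (\<integral>\<^sup>+r. g (fst p r) \<partial>lebesgue_on {s..t})"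
  using line_integral_subcurve[OF assms] by (simp add: gradient_ineq_def subcurve_def)

text \<open>
  By the convention on differences of infinite values, a finite bound on \<open>\<bar>u (\<gamma> s) - u (\<gamma> t)\<bar>\<close> forces
  both values to be finite. This makes \<open>u \<circ> \<gamma>\<close> a real function, to which the estimate of
  increments applies.
\<close>

lemma gradient_ineq_INF:
  fixes f :: "nat \<Rightarrow> 'a \<Rightarrow> ennreal"
  assumes p: "p \<in> curves"
    and meas: "\<And>n. (\<lambda>r. f n (fst p r)) \<in> borel_measurable (lebesgue_on {0..snd p})"
    and fin: "\<And>n. line_integral p (f n) < \<infinity>"
    and sub: "\<And>n s t. \<lbrakk>0 \<le> s; s < t; t \<le> snd p\<rbrakk> \<Longrightarrow> gradient_ineq u (f n) (subcurve p s t)"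
  shows "gradient_ineq u (\<lambda>x. INF n. f n x) p"
proof -
  let ?l = "snd p" and ?w = "\<lambda>r. u (fst p r)"
  define v where "v r = real_of_ereal (?w r)" for r
  have l: "0 < ?l"
    using p by (auto simp: curves_def)
  have ineq: "\<bar>?w s - ?w t\<bar> \<le> enn2ereal (\<integral>\<^sup>+r. f n (fst p r) \<partial>lebesgue_on {s..t})"
    if "0 \<le> s" "s < t" "t \<le> ?l" for n s t
    using sub[OF that, of n] gradient_ineq_subcurve_iff[OF meas, of s t u n] that by simp
  have finite_pair: "\<bar>?w s\<bar> \<noteq> \<infinity> \<and> \<bar>?w t\<bar> \<noteq> \<infinity>" if "0 \<le> s" "s < t" "t \<le> ?l" for s t
  proof -
    have "(\<integral>\<^sup>+r. f 0 (fst p r) \<partial>lebesgue_on {s..t}) \<le> line_integral p (f 0)"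
      unfolding line_integral_def using that by (intro nn_integral_lebesgue_on_mono_set) auto
    then have "(\<integral>\<^sup>+r. f 0 (fst p r) \<partial>lebesgue_on {s..t}) < \<infinity>"
      using fin[of 0] by (rule order_le_less_trans)
    then have "\<bar>?w s - ?w t\<bar> \<noteq> \<infinity>"
      using ineq[OF that, of 0] by (auto simp: less_top_ennreal)
    then show ?thesis
      by (cases "?w s"; cases "?w t") auto
  qed
  \<comment> \<open>Every parameter is an endpoint of a nondegenerate subinterval.\<close>
  have w: "?w r = ereal (v r)" if "0 \<le> r" "r \<le> ?l" for r
  proof (cases "r = 0")
    case True
    then show ?thesis
      using finite_pair[of 0 ?l] l by (simp add: v_def ereal_real)
  next
    case False
    then show ?thesis
      using finite_pair[of 0 r] that by (simp add: v_def ereal_real)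
  qed
  have "bounds_increments 0 ?l v (\<lambda>r. f n (fst p r))" for n
  proof -
    have "ennreal \<bar>v t - v s\<bar> \<le> (\<integral>\<^sup>+r. f n (fst p r) \<partial>lebesgue_on {s..t})"
      if "0 \<le> s" "s \<le> t" "t \<le> ?l" for s t
    proof (cases "s = t")
      case False
      then show ?thesis
        using ineq[of s t n] w[of s] w[of t] that
        by (simp add: less_eq_ennreal.rep_eq abs_minus_commute)
    qed simp
    then show ?thesis
      using meas fin by (auto simp: bounds_increments_def line_integral_def)
  qed
  then have "bounds_increments 0 ?l v (\<lambda>r. INF n. f n (fst p r))"
    by (rule bounds_increments_INF)
  then have "ennreal \<bar>v ?l - v 0\<bar> \<le> line_integral p (\<lambda>x. INF n. f n x)"
    using l by (simp add: bounds_increments_def line_integral_def)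
  then show ?thesis
    using w[of 0] w[of ?l] l
    by (simp add: gradient_ineq_def less_eq_ennreal.rep_eq abs_minus_commute)
qed

text \<open>
  Almost every curve is good for the whole sequence at once, together with all its subcurves.
\<close>

lemma lattice_weak_upper_gradients_INF:
  assumes f: "\<And>n::nat. f n \<in> lattice_weak_upper_gradients u"
  shows "(\<lambda>x. INF n. f n x) \<in> lattice_weak_upper_gradients u"
proof -
  let ?good = "\<lambda>n p. (\<lambda>r. f n (fst p r)) \<in> borel_measurable (lebesgue_on {0..snd p}) \<and>
    gradient_ineq u (f n) p"
  have fM[measurable]: "f n \<in> borel_measurable M"
    and norm_f: "N (\<lambda>x. enn2ereal (f n x)) < \<infinity>"
    and good: "ae_curve N (?good n)" for n
    using f[of n] by (auto simp: lattice_weak_upper_gradients_def weak_upper_gradient_def lattice_space_def)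
  have INF_M[measurable]: "(\<lambda>x. INF n. f n x) \<in> borel_measurable M"
    by measurable
  have "ae_curve N (\<lambda>p. \<forall>n. (line_integral p (f n) < \<infinity> \<and> ?good n p) \<and>
      (\<forall>s t. 0 \<le> s \<longrightarrow> s < t \<longrightarrow> t \<le> snd p \<longrightarrow> ?good n (subcurve p s t)))"
    by (intro ae_curve_all ae_curve_conj ae_curve_line_integral_finite ae_curve_subcurves fM norm_f good)
  then have "ae_curve N (\<lambda>p.
      (\<lambda>r. INF n. f n (fst p r)) \<in> borel_measurable (lebesgue_on {0..snd p}) \<and>
      gradient_ineq u (\<lambda>x. INF n. f n x) p)"
    by (rule ae_curve_mono) (auto intro!: gradient_ineq_INF borel_measurable_INF)
  moreover have "N (\<lambda>x. enn2ereal (INF n. f n x)) \<le> N (\<lambda>x. enn2ereal (f 0 x))"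
    by (intro lattice_property) (auto simp flip: less_eq_ennreal.rep_eq intro: INF_lower)
  ultimately show ?thesis
    using INF_M norm_f[of 0]
    by (auto simp: lattice_weak_upper_gradients_def weak_upper_gradient_def lattice_space_def
        intro: order_le_less_trans)
qed

end

section \<open>The minimal weak upper gradient\<close>

theorem theorem4p6:
  fixes M :: "'a::metric_space measure"
    and N :: "('a \<Rightarrow> ereal) \<Rightarrow> ennreal"
    and c :: real
    and u :: "'a \<Rightarrow> ereal"
  assumes "quasi_banach_function_lattice M N c"
    and "u \<in> dirichlet_space M N"
  shows "(\<exists>g. minimal_weak_upper_gradient M N u g) \<and>
    (\<forall>g g'. minimal_weak_upper_gradient M N u g \<and> minimal_weak_upper_gradient M N u g'
      \<longrightarrow> (AE x in M. g x = g' x))"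
proof (intro conjI allI impI)
  interpret quasi_banach_function_lattice M N c by fact
  have "lattice_weak_upper_gradients u \<noteq> {}"
    using assms(2) upper_gradient_imp_weak
    by (auto simp: dirichlet_space_def lattice_weak_upper_gradients_def)
  moreover have "lattice_weak_upper_gradients u \<subseteq> borel_measurable M"
    by (auto simp: lattice_weak_upper_gradients_def weak_upper_gradient_def)
  ultimately obtain g where "g \<in> lattice_weak_upper_gradients u"
      "\<And>h. h \<in> lattice_weak_upper_gradients u \<Longrightarrow> AE x in M. g x \<le> h x"
    using ex_AE_least[of "lattice_weak_upper_gradients u"] lattice_weak_upper_gradients_INF by blast
  then show "\<exists>g. minimal_weak_upper_gradient M N u g"
    by (auto simp: minimal_weak_upper_gradient_def lattice_weak_upper_gradients_def)
next
  fix g g' assume "minimal_weak_upper_gradient M N u g \<and> minimal_weak_upper_gradient M N u g'"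
  then have "AE x in M. g x \<le> g' x" "AE x in M. g' x \<le> g x"
    by (auto simp: minimal_weak_upper_gradient_def)
  then show "AE x in M. g x = g' x"
    by eventually_elim (rule antisym)
qed

end
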